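(* Let $\succ$ be a binary relation (a not necessarily strict preference relation) on the real linear space $Y$ with pre-domination structure $\tilde D_\succ$, and let $D\subseteq Y$. Then $D$ is a domination set of $\succ$ if and only if $\tilde D_\succ(y)=D$ for all $y\in Y$.
   Context: For a binary relation $\succ$ on $Y$: the domination structure is $D_\succ:Y\to\mathcal P(Y)$, $D_\succ(y):=\{d\in Y\mid y\succ y+d\}$; the pre-domination structure is $\tilde D_\succ:Y\to\mathcal P(Y)$, $\tilde D_\succ(y):=\{\tilde d\in Y\mid y-\tilde d\succ y\}$. A set $D\subseteq Y$ is the domination set of $\succ$ if $D_\succ(y)=D$ for all $y\in Y$. *)

theory Defs
  imports Complex_Main
begin

(* The argument R is the relation: R y z stands for y \<succ> z. *)

definition domination_structure :: "('a::real_vector \<Rightarrow> 'a \<Rightarrow> bool) \<Rightarrow> 'a \<Rightarrow> 'a set" where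
  "domination_structure R y = {d. R y (y + d)}"

definition pre_domination_structure :: "('a::real_vector \<Rightarrow> 'a \<Rightarrow> bool) \<Rightarrow> 'a \<Rightarrow> 'a set" where
  "pre_domination_structure R y = {d. R (y - d) y}"

definition domination_set :: "('a::real_vector \<Rightarrow> 'a \<Rightarrow> bool) \<Rightarrow> 'a set \<Rightarrow> bool" where
  "domination_set R D \<longleftrightarrow> (\<forall>y. domination_structure R y = D)"

end

theory Submission
  imports Defs
begin

text \<open>Both structures record the same comparisons \<open>R z (z + d)\<close>; the domination structure
  files the comparison under its first point and the pre-domination structure under its second.
  Passing from one to the other thus shifts the base point by \<open>d\<close>. For fixed \<open>d\<close> this shift is a
  bijection of the space, so membership of \<open>d\<close> that does not depend on the base point in one
  structure does not depend on it in the other.\<close>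

lemma mem_pre_domination_structure_iff:
  "d \<in> pre_domination_structure R y \<longleftrightarrow> d \<in> domination_structure R (y - d)"
  by (simp add: pre_domination_structure_def domination_structure_def)

lemma mem_domination_structure_iff:
  "d \<in> domination_structure R y \<longleftrightarrow> d \<in> pre_domination_structure R (y + d)"
  by (simp add: mem_pre_domination_structure_iff)

theorem proposition3:
  fixes R :: "'a::real_vector \<Rightarrow> 'a \<Rightarrow> bool" and D :: "'a set"
  shows "domination_set R D \<longleftrightarrow> (\<forall>y. pre_domination_structure R y = D)"
proof
  assume "domination_set R D"
  then show "\<forall>y. pre_domination_structure R y = D"
    by (simp add: domination_set_def set_eq_iff mem_pre_domination_structure_iff)
next
  assume "\<forall>y. pre_domination_structure R y = D"
  then show "domination_set R D"
    by (simp add: domination_set_def set_eq_iff mem_domination_structure_iff)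
qed

end
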